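(* Suppose that the standing assumptions (SA1), (SA2), (SA3) and Assumption 2 of the context hold. Then the sequence of functions $V_r^i$ generated by PI$^+$ monotonically compactly converges to $V^\star$, i.e.: (i) for all $i\in\mathbb{Z}_{\ge0}$ and $x\in\mathbb{R}^{n_x}$, $V_r^{i+1}(x)\le V_r^i(x)$; (ii) for any compact set $K\subset\mathbb{R}^{n_x}$ and $\delta>0$ there exists $i^\star\in\mathbb{Z}_{>0}$ such that, for any $x\in K$ and $i\ge i^\star$, $V_r^i(x)-V^\star(x)\le\delta$.
   Context: Notation. $\mathbb{R}_{\ge0}=[0,\infty)$, $\mathbb{Z}_{\ge0}=\{0,1,\dots\}$, $\mathbb{Z}_{>0}=\{1,2,\dots\}$; $\mathbb{B}$ is the closed unit ball of $\mathbb{R}^{n_x}$. $\mathcal{K}_\infty$: continuous, strictly increasing, unbounded functions $\mathbb{R}_{\ge0}\to\mathbb{R}_{\ge0}$ that are zero at zero. A selection of a set-valued map $S$ is a single-valued $s$ with $s(x)\in S(x)$ for all $x\in\operatorname{dom}S$; one writes $s\in S$. A set-valued map $S$ is outer semicontinuous if $x_n\to x$, $u_n\in S(x_n)$, $u_n\to u$ imply $u\in S(x)$. For a set $A$, $S(A)=\bigcup_{a\in A}S(a)$. A function $\ell(x,u)$ is level-bounded in $u$, locally uniform in $x$, if for each $x\in\mathbb{R}^{n_x}$ and $\alpha\in\mathbb{R}$ there are a neighborhood $\mathcal{S}$ of $x$ and a bounded set $B\subset\mathbb{R}^{n_u}$ such that $\{u:\ell(z,u)\le\alpha\}\subset B$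 for all $z\in\mathcal{S}$. Plant and cost. $x(k+1)=f(x(k),u(k))$ with $x\in\mathbb{R}^{n_x}$, $u\in\mathcal{U}(x)\subseteq\mathbb{R}^{n_u}$, $\mathcal{U}(x)\neq\emptyset$ for every $x$; $\mathcal{W}=\{(x,u):u\in\mathcal{U}(x)\}$. The stage cost is $\ell:\mathbb{R}^{n_x}\times\mathbb{R}^{n_u}\to\mathbb{R}_{\ge0}$. For an admissible infinite input sequence $\mathbf{u}$, $J(x,\mathbf{u})=\sum_{k=0}^\infty\ell(x(k),u(k))$ along the resulting solution from $x(0)=x$. For a policy $h\in\mathcal{U}$, $\phi(k,x,h)$ is the closed-loop solution from $x$ and $J(x,h)=\sum_{k=0}^\infty\ell(\phi(k,x,h),h(\phi(k,x,h)))$. $V^\star(x)=\min_{\mathbf{u}}J(x,\mathbf{u})$. Standing assumptions. $\sigma:\mathbb{R}^{n_x}\to\mathbb{R}_{\ge0}$ is continuous, and $h^0\in\mathcal{U}$ is a given initial policy. (SA1) For every $x$ there is an admissible input sequence $\mathbf{u}^\star(x)$ attaining the minimum $V^\star(x)=J(x,\mathbf{u}^\star(x))<+\infty$. (SA2) There exist a continuous $W:\mathbb{R}^{n_x}\to\mathbb{R}_{\ge0}$, $\alpha_W,\chi_W\in\mathcal{K}_\infty$ and $\overline\alpha_W:\mathbb{R}_{\ge0}\to\mathbb{R}_{\ge0}$ continuous, nondecreasing and zero at zero such that for all $(x,u)\in\mathcal{W}$: $W(x)\le\overline\alpha_W(\sigma(x))$ and $W(f(x,u))-W(x)\le-\alpha_W(\sigma(x))+\chi_W(\ell(x,u))$.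 (SA3) There exists $\overline\alpha_V\in\mathcal{K}_\infty$ with $J(x,h^0)\le\overline\alpha_V(\sigma(x))$ for all $x\in\mathbb{R}^{n_x}$. Algorithm PI$^+$. $V_r^0:=J(\cdot,h^0)$, $H^0:=H_r^0:=H_r^{\star,0}:=\{h^0\}$. For $i\in\mathbb{Z}_{\ge0}$ and all $x$: $H^{i+1}(x):=\operatorname{argmin}_{u\in\mathcal{U}(x)}\{\ell(x,u)+V_r^i(f(x,u))\}$; $H_r^{i+1}(x):=\bigcap_{\delta>0}\overline{H^{i+1}(x+\delta\mathbb{B})}$; $V_r^{i+1}(x):=\min_{h\in H_r^{i+1}}J(x,h)$ (minimum over selections $h$ of $H_r^{i+1}$); $H_r^{\star,i+1}(x):=\operatorname{argmin}_{u\in H_r^{i+1}(x)}\{\ell(x,u)+V_r^{i+1}(f(x,u))\}$. Assumption 2. (i) $f$ and $\ell$ are continuous on $\mathbb{R}^{n_x}\times\mathbb{R}^{n_u}$. (ii) $\ell$ is level-bounded in $u$, locally uniform in $x$. (iii) $\mathcal{U}$ is outer semicontinuous on $\mathbb{R}^{n_x}$. (iv) $V_r^0=J(\cdot,h^0)$ is lower semicontinuous on $\mathbb{R}^{n_x}$. (v) For all $\Delta>0$, $\{x:\sigma(x)\le\Delta\}$ is compact. *)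

theory Defs
  imports "HOL-Analysis.Analysis"
begin

(* The half-line [0,\<infinity>) is represented by the nonnegative part of type real; values at
   negative arguments are irrelevant. *)

definition class_K_inf :: "(real \<Rightarrow> real) \<Rightarrow> bool" where
  "class_K_inf \<alpha> \<longleftrightarrow>
     continuous_on {0..} \<alpha> \<and> strict_mono_on {0..} \<alpha> \<and> \<alpha> 0 = 0 \<and> \<not> bounded (\<alpha> ` {0..})"

definition selection :: "('a \<Rightarrow> 'b set) \<Rightarrow> ('a \<Rightarrow> 'b) \<Rightarrow> bool" where
  "selection S s \<longleftrightarrow> (\<forall>x. S x \<noteq> {} \<longrightarrow> s x \<in> S x)"

definition outer_semicontinuous ::
    "('a::topological_space \<Rightarrow> 'b::topological_space set) \<Rightarrow> bool" where
  "outer_semicontinuous S \<longleftrightarrow>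
     (\<forall>X Y x u. X \<longlonglongrightarrow> x \<and> (\<forall>n::nat. Y n \<in> S (X n)) \<and> Y \<longlonglongrightarrow> u \<longrightarrow> u \<in> S x)"

definition lower_semicontinuous :: "('a::topological_space \<Rightarrow> ereal) \<Rightarrow> bool" where
  "lower_semicontinuous g \<longleftrightarrow> (\<forall>x. g x \<le> Liminf (at x) g)"

definition level_bounded_locally_uniform ::
    "('a::topological_space \<Rightarrow> 'b::metric_space \<Rightarrow> real) \<Rightarrow> bool" where
  "level_bounded_locally_uniform l \<longleftrightarrow>
     (\<forall>x \<alpha>. \<exists>S B. open S \<and> x \<in> S \<and> bounded B \<and> (\<forall>z\<in>S. {u. l z u \<le> \<alpha>} \<subseteq> B))"

definition argmin_set :: "('b \<Rightarrow> ereal) \<Rightarrow> 'b set \<Rightarrow> 'b set" where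
  "argmin_set g A = {u. is_arg_min g (\<lambda>v. v \<in> A) u}"

(* A genuine minimum: the value is meaningful only if the minimum is attained. *)
definition minimum :: "ereal set \<Rightarrow> ereal" where
  "minimum A = (LEAST v. v \<in> A)"


primrec traj :: "('x \<Rightarrow> 'u \<Rightarrow> 'x) \<Rightarrow> 'x \<Rightarrow> (nat \<Rightarrow> 'u) \<Rightarrow> nat \<Rightarrow> 'x" where
  "traj f x u 0 = x"
| "traj f x u (Suc k) = f (traj f x u k) (u k)"

definition admissible :: "('x \<Rightarrow> 'u \<Rightarrow> 'x) \<Rightarrow> ('x \<Rightarrow> 'u set) \<Rightarrow> 'x \<Rightarrow> (nat \<Rightarrow> 'u) \<Rightarrow> bool" where
  "admissible f U x u \<longleftrightarrow> (\<forall>k. u k \<in> U (traj f x u k))"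

(* Costs of nonnegative stage costs may diverge, hence the extended real values. *)
definition seq_cost ::
    "('x \<Rightarrow> 'u \<Rightarrow> 'x) \<Rightarrow> ('x \<Rightarrow> 'u \<Rightarrow> real) \<Rightarrow> 'x \<Rightarrow> (nat \<Rightarrow> 'u) \<Rightarrow> ereal" where
  "seq_cost f l x u = (\<Sum>k. ereal (l (traj f x u k) (u k)))"

primrec closed_loop :: "('x \<Rightarrow> 'u \<Rightarrow> 'x) \<Rightarrow> ('x \<Rightarrow> 'u) \<Rightarrow> 'x \<Rightarrow> nat \<Rightarrow> 'x" where
  "closed_loop f h x 0 = x"
| "closed_loop f h x (Suc k) = f (closed_loop f h x k) (h (closed_loop f h x k))"

definition policy_cost ::
    "('x \<Rightarrow> 'u \<Rightarrow> 'x) \<Rightarrow> ('x \<Rightarrow> 'u \<Rightarrow> real) \<Rightarrow> ('x \<Rightarrow> 'u) \<Rightarrow> 'x \<Rightarrow> ereal" where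
  "policy_cost f l h x = (\<Sum>k. ereal (l (closed_loop f h x k) (h (closed_loop f h x k))))"

definition optimal_value ::
    "('x \<Rightarrow> 'u \<Rightarrow> 'x) \<Rightarrow> ('x \<Rightarrow> 'u \<Rightarrow> real) \<Rightarrow> ('x \<Rightarrow> 'u set) \<Rightarrow> 'x \<Rightarrow> ereal" where
  "optimal_value f l U x = minimum {seq_cost f l x u |u. admissible f U x u}"

fun PI_H :: "('x::metric_space \<Rightarrow> 'u::topological_space \<Rightarrow> 'x) \<Rightarrow> ('x \<Rightarrow> 'u \<Rightarrow> real) \<Rightarrow>
      ('x \<Rightarrow> 'u set) \<Rightarrow> ('x \<Rightarrow> 'u) \<Rightarrow> nat \<Rightarrow> 'x \<Rightarrow> 'u set"
and PI_Hr :: "('x \<Rightarrow> 'u \<Rightarrow> 'x) \<Rightarrow> ('x \<Rightarrow> 'u \<Rightarrow> real) \<Rightarrow>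
      ('x \<Rightarrow> 'u set) \<Rightarrow> ('x \<Rightarrow> 'u) \<Rightarrow> nat \<Rightarrow> 'x \<Rightarrow> 'u set"
and PI_Vr :: "('x \<Rightarrow> 'u \<Rightarrow> 'x) \<Rightarrow> ('x \<Rightarrow> 'u \<Rightarrow> real) \<Rightarrow>
      ('x \<Rightarrow> 'u set) \<Rightarrow> ('x \<Rightarrow> 'u) \<Rightarrow> nat \<Rightarrow> 'x \<Rightarrow> ereal"
where
  "PI_H f l U h0 0 = (\<lambda>x. {h0 x})"
| "PI_H f l U h0 (Suc i) =
     (\<lambda>x. argmin_set (\<lambda>u. ereal (l x u) + PI_Vr f l U h0 i (f x u)) (U x))"
| "PI_Hr f l U h0 0 = (\<lambda>x. {h0 x})"
| "PI_Hr f l U h0 (Suc i) =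
     (\<lambda>x. \<Inter>\<delta>\<in>{0<..}. closure (\<Union>z\<in>cball x \<delta>. PI_H f l U h0 (Suc i) z))"
| "PI_Vr f l U h0 0 = policy_cost f l h0"
| "PI_Vr f l U h0 (Suc i) =
     (\<lambda>x. minimum {policy_cost f l h x |h. selection (PI_Hr f l U h0 (Suc i)) h})"

(* The policies returned by the algorithm; they do not feed back into the iteration. *)
fun PI_Hr_star :: "('x::metric_space \<Rightarrow> 'u::topological_space \<Rightarrow> 'x) \<Rightarrow> ('x \<Rightarrow> 'u \<Rightarrow> real) \<Rightarrow>
      ('x \<Rightarrow> 'u set) \<Rightarrow> ('x \<Rightarrow> 'u) \<Rightarrow> nat \<Rightarrow> 'x \<Rightarrow> 'u set" where
  "PI_Hr_star f l U h0 0 = (\<lambda>x. {h0 x})"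
| "PI_Hr_star f l U h0 (Suc i) =
     (\<lambda>x. argmin_set (\<lambda>u. ereal (l x u) + PI_Vr f l U h0 (Suc i) (f x u))
            (PI_Hr f l U h0 (Suc i) x))"

end

theory Submission
  imports Defs
begin

text \<open>
  Each \<open>V\<^sub>r\<^sup>i\<close> is lower semicontinuous and is the cost of one policy that is optimal from every
  initial state at once. Indeed the greedy controls are locally bounded, so their regularization
  has a closed graph and compact values, and value iteration over such a map converges to a lower
  semicontinuous value function attained by a feedback. Since the greedy controls themselves remain
  available, \<open>V\<^sub>r\<^sup>i\<^sup>+\<^sup>1 \<le> V\<^sub>r\<^sup>i\<close> and \<open>V\<^sub>r\<^sup>i\<^sup>+\<^sup>1(x) \<le> l(x, u) + V\<^sub>r\<^sup>i(f(x, u))\<close> for all \<open>u \<in> U(x)\<close>.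

  Following an optimal trajectory \<open>x\<^sub>k\<close> from \<open>x\<close> gives \<open>V\<^sub>r\<^sup>i(x) - V\<^sup>\<star>(x) \<le> V\<^sub>r\<^sup>0(x\<^sub>k)\<close> for every \<open>k \<le> i\<close>,
  so it suffices that the trajectory visits \<open>{\<sigma> \<le> \<epsilon>}\<close> within a number of steps that is uniform on
  compact sets. No KL stability estimate is needed for this.
\<close>

subsection \<open>Lower semicontinuity\<close>

text \<open>The filter \<open>at x\<close> ignores \<open>x\<close> itself, where the strict bound
  holds anyway, so it extends to a full neighborhood. Real thresholds suffice because the reals are
  dense in \<open>ereal\<close>.\<close>

lemma lower_semicontinuous_iff_closed_sublevel:
  "lower_semicontinuous g \<longleftrightarrow> (\<forall>r::real. closed {x. g x \<le> ereal r})"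
proof
  assume lsc: "lower_semicontinuous g"
  show "\<forall>r::real. closed {x. g x \<le> ereal r}"
  proof
    fix r :: real
    have "\<forall>\<^sub>F y in nhds x. ereal r < g y" if "ereal r < g x" for x
    proof -
      have "\<forall>\<^sub>F y in at x. ereal r < g y"
        using lsc that unfolding lower_semicontinuous_def le_Liminf_iff by blast
      then show ?thesis
        unfolding eventually_at_filter by (rule eventually_mono) (use that in auto)
    qed
    then have "open {x. ereal r < g x}"
      by (subst open_subopen) (simp add: eventually_nhds subset_eq)
    then show "closed {x. g x \<le> ereal r}"
      by (simp add: closed_def Collect_neg_eq[symmetric] not_le)
  qed
next
  assume cl: "\<forall>r::real. closed {x. g x \<le> ereal r}"
  have "\<forall>\<^sub>F y in at x. t < g y" if t: "t < g x" for t x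
  proof -
    obtain r where r: "t < ereal r" "ereal r < g x"
      using ereal_dense2[OF t] by blast
    have "open {y. ereal r < g y}"
      using cl by (simp add: closed_def Collect_neg_eq[symmetric] not_le)
    then have "\<forall>\<^sub>F y in at x. ereal r < g y"
      using r(2) by (auto simp: eventually_at_topological)
    then show ?thesis
      by (rule eventually_mono) (rule less_trans[OF r(1)])
  qed
  then show "lower_semicontinuous g"
    by (simp add: lower_semicontinuous_def le_Liminf_iff)
qed

text \<open>The joint form in \<open>(x, r)\<close> serves bounds such as
  \<open>V (f x u) \<le> r - l x u\<close>, where both sides vary with the control. A real number
  strictly between \<open>r\<close> and \<open>g x\<close> separates the two coordinates.\<close>

lemma lower_semicontinuous_imp_closed_epigraph:
  assumes "lower_semicontinuous g"
  shows "closed {(x, r::real). g x \<le> ereal r}"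
proof -
  have "\<exists>T. open T \<and> (x, r) \<in> T \<and> T \<subseteq> {(x, r). ereal r < g x}" if rx: "ereal r < g x" for x r
  proof -
    obtain s where s: "ereal r < ereal s" "ereal s < g x"
      using ereal_dense2[OF rx] by blast
    have "open {y. ereal s < g y}"
      using assms unfolding lower_semicontinuous_iff_closed_sublevel
      by (simp add: closed_def Collect_neg_eq[symmetric] not_le)
    then have "open ({y. ereal s < g y} \<times> {..<s})"
      by (intro open_Times open_lessThan)
    then show ?thesis
      using s by (intro exI[of _ "{y. ereal s < g y} \<times> {..<s}"])
        (auto intro: less_trans[of _ "ereal s"])
  qed
  then have "open {(x, r). ereal r < g x}"
    by (subst open_subopen) auto
  moreover have "{(x, r). ereal r < g x} = - {(x, r). g x \<le> ereal r}"
    by auto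
  ultimately show ?thesis
    by (simp add: closed_def)
qed

lemma lower_semicontinuous_SUP:
  assumes "\<And>i. i \<in> I \<Longrightarrow> lower_semicontinuous (g i)"
  shows "lower_semicontinuous (\<lambda>x. SUP i\<in>I. g i x)"
proof -
  have "{x. (SUP i\<in>I. g i x) \<le> ereal r} = (\<Inter>i\<in>I. {x. g i x \<le> ereal r})" for r
    by (auto simp: SUP_le_iff)
  then show ?thesis
    using assms by (auto simp: lower_semicontinuous_iff_closed_sublevel)
qed

text \<open>The sublevel sets at heights \<open>1 / Suc n\<close> above a finite infimum are nested,
  nonempty and compact, and any common point attains it. If \<open>g\<close> is infinite on all of
  \<open>A\<close>, every point of \<open>A\<close> is a minimizer.\<close>

lemma attains_min_compact_sublevels:
  fixes g :: "'b::heine_borel \<Rightarrow> ereal"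
  assumes ne: "A \<noteq> {}" and nonneg: "\<And>u. u \<in> A \<Longrightarrow> 0 \<le> g u"
    and comp: "\<And>r::real. compact {u \<in> A. g u \<le> ereal r}"
  shows "\<exists>u\<in>A. \<forall>v\<in>A. g u \<le> g v"
proof (cases "\<exists>a\<in>A. g a < \<infinity>")
  case False
  then show ?thesis using ne by force
next
  case True
  define m where "m = (INF u\<in>A. g u)"
  have "0 \<le> m" unfolding m_def using nonneg by (rule INF_greatest)
  moreover have "m < \<infinity>"
    using True unfolding m_def by (meson INF_lower le_less_trans)
  ultimately obtain r where r: "m = ereal r" by (cases m) auto
  define F where "F n = {u \<in> A. g u \<le> ereal (r + 1 / Suc n)}" for n :: nat
  have "\<Inter>(range F) \<noteq> {}"
  proof (rule compact_nest)
    show "compact (F n)" for n unfolding F_def by (rule comp)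
    have "m < ereal (r + 1 / Suc n)" for n by (simp add: r)
    then show "F n \<noteq> {}" for n
      unfolding F_def m_def INF_less_iff by (fastforce dest: less_imp_le)
    show "F n \<subseteq> F k" if "k \<le> n" for k n
    proof -
      have "1 / real (Suc n) \<le> 1 / real (Suc k)"
        using that by (simp add: frac_le)
      then have "ereal (r + 1 / Suc n) \<le> ereal (r + 1 / Suc k)" by simp
      then show ?thesis unfolding F_def by (blast intro: order_trans)
    qed
  qed
  then obtain u where u: "\<And>n. u \<in> F n" by blast
  have "g u \<le> m"
  proof (rule ereal_le_epsilon2)
    fix e :: real assume "0 < e"
    then obtain n where "1 / real (Suc n) < e"
      using nat_approx_posE by metis
    then have "ereal (r + 1 / Suc n) \<le> m + ereal e" by (simp add: r)
    then show "g u \<le> m + ereal e"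
      using u[of n] unfolding F_def by (blast intro: order_trans)
  qed
  then show ?thesis
    using u[of 0] unfolding F_def m_def by (blast intro: INF_lower order_trans)
qed

subsection \<open>Locally bounded set-valued maps\<close>

text \<open>One bound serves a whole neighborhood of states; combined with a closed graph this gives
  compact values and closed projections.\<close>

definition locally_bounded :: "('a::topological_space \<Rightarrow> 'b::metric_space set) \<Rightarrow> bool" where
  "locally_bounded S \<longleftrightarrow> (\<forall>x. \<exists>N. open N \<and> x \<in> N \<and> bounded (\<Union>z\<in>N. S z))"

text \<open>Projection along a compact factor preserves closedness. Near a given state the controls
  can be confined to the closure of a bounded set, so the argument works locally.\<close>

lemma closed_fst_image_locally_bounded:
  fixes S :: "'a::heine_borel \<Rightarrow> 'b::heine_borel set"
  assumes "closed C" and sub: "C \<subseteq> Sigma UNIV S" and "locally_bounded S"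
  shows "closed (fst ` C)"
proof -
  have "x \<in> fst ` C" if x: "x \<in> closure (fst ` C)" for x
  proof -
    obtain N where N: "open N" "x \<in> N" "bounded (\<Union>z\<in>N. S z)"
      using \<open>locally_bounded S\<close> unfolding locally_bounded_def by blast
    obtain r where r: "0 < r" "cball x r \<subseteq> N"
      using N open_contains_cball by blast
    define D where "D = C \<inter> (cball x r \<times> closure (\<Union>z\<in>N. S z))"
    have "compact D"
      unfolding D_def using N(3) \<open>closed C\<close>
      by (intro closed_Int_compact compact_Times compact_cball) simp_all
    then have "compact (fst ` D)"
      by (intro compact_continuous_image continuous_intros)
    moreover have "ball x r \<inter> fst ` C \<subseteq> fst ` D"
    proof
      fix y assume "y \<in> ball x r \<inter> fst ` C"
      then obtain u where u: "(y, u) \<in> C" "y \<in> cball x r" by force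
      then have "u \<in> (\<Union>z\<in>N. S z)" using r sub by blast
      then have "u \<in> closure (\<Union>z\<in>N. S z)" by (rule subsetD[OF closure_subset])
      then have "(y, u) \<in> D" using u unfolding D_def by simp
      then show "y \<in> fst ` D" by force
    qed
    ultimately have "closure (ball x r \<inter> fst ` C) \<subseteq> fst ` D"
      by (simp add: closure_minimal compact_imp_closed)
    moreover have "x \<in> closure (ball x r \<inter> fst ` C)"
      using open_Int_closure_subset[OF open_ball, of x r "fst ` C"] x r(1) by auto
    ultimately show ?thesis unfolding D_def by blast
  qed
  then show ?thesis
    by (simp add: closure_subset_eq[symmetric] subsetI)
qed

lemma compact_value_locally_bounded:
  fixes S :: "'a::heine_borel \<Rightarrow> 'b::heine_borel set"
  assumes "closed C" "C \<subseteq> Sigma UNIV S" "locally_bounded S"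
  shows "compact (Pair x -` C)"
proof -
  have "closed (Pair x -` C)"
    using \<open>closed C\<close> by (intro continuous_closed_vimage) (auto intro!: continuous_intros)
  moreover have "bounded (S x)"
    using \<open>locally_bounded S\<close> unfolding locally_bounded_def
    by (meson UN_upper bounded_subset)
  then have "bounded (Pair x -` C)"
    by (rule bounded_subset) (use assms(2) in auto)
  ultimately show ?thesis by (simp add: compact_eq_bounded_closed)
qed

lemma outer_semicontinuous_imp_closed_graph:
  fixes S :: "'a::metric_space \<Rightarrow> 'b::metric_space set"
  assumes "outer_semicontinuous S"
  shows "closed (Sigma UNIV S)"
  unfolding closed_sequential_limits
proof (intro allI impI, elim conjE)
  fix X and p :: "'a \<times> 'b"
  assume X: "\<forall>n. X n \<in> Sigma UNIV S" "X \<longlonglongrightarrow> p"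
  have "(\<lambda>n. fst (X n)) \<longlonglongrightarrow> fst p" "(\<lambda>n. snd (X n)) \<longlonglongrightarrow> snd p"
    using X(2) by (auto intro: tendsto_intros)
  moreover have "\<forall>n. snd (X n) \<in> S (fst (X n))"
    using X(1) by (metis SigmaE fst_conv snd_conv)
  ultimately have "snd p \<in> S (fst p)"
    using assms[unfolded outer_semicontinuous_def, rule_format,
        of "\<lambda>n. fst (X n)" "fst p" "\<lambda>n. snd (X n)" "snd p"] by blast
  then show "p \<in> Sigma UNIV S" by (cases p) simp
qed

text \<open>This is the regularization that turns \<open>PI_H\<close> into \<open>PI_Hr\<close>,
  stated for an arbitrary map: its outer semicontinuous hull.\<close>

definition osc_hull :: "('a::metric_space \<Rightarrow> 'b::topological_space set) \<Rightarrow> 'a \<Rightarrow> 'b set" where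
  "osc_hull H x = (\<Inter>\<delta>\<in>{0<..}. closure (\<Union>z\<in>cball x \<delta>. H z))"

lemma subset_osc_hull: "H x \<subseteq> osc_hull H x"
  unfolding osc_hull_def
proof (intro INT_greatest)
  fix \<delta> :: real assume "\<delta> \<in> {0<..}"
  then have "H x \<subseteq> (\<Union>z\<in>cball x \<delta>. H z)" by (intro UN_upper) simp
  then show "H x \<subseteq> closure (\<Union>z\<in>cball x \<delta>. H z)" using closure_subset by blast
qed

text \<open>Shrinking balls of states and the closure in the controls together express approximation
  of \<open>(x, u)\<close> in the product metric. The hull is therefore the smallest map above
  \<open>H\<close> with a closed graph.\<close>

lemma Sigma_osc_hull:
  fixes H :: "'a::metric_space \<Rightarrow> 'b::metric_space set"
  shows "Sigma UNIV (osc_hull H) = closure (Sigma UNIV H)"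
proof (intro subset_antisym subrelI)
  fix x u
  assume "(x, u) \<in> Sigma UNIV (osc_hull H)"
  then have u: "u \<in> osc_hull H x" by simp
  show "(x, u) \<in> closure (Sigma UNIV H)"
    unfolding closure_approachable
  proof (intro allI impI)
    fix e :: real assume e: "0 < e"
    then have "u \<in> closure (\<Union>z\<in>cball x (e/2). H z)"
      using u unfolding osc_hull_def by (auto dest: INT_D)
    then obtain z v where z: "z \<in> cball x (e/2)" "v \<in> H z" "dist v u < e/2"
      unfolding closure_approachable using e half_gt_zero by blast
    have "dist (z, v) (x, u) \<le> dist z x + dist v u"
      unfolding dist_Pair_Pair by (intro sqrt_sum_squares_le_sum) auto
    also have "\<dots> < e" using z by (simp add: dist_commute)
    finally show "\<exists>y\<in>Sigma UNIV H. dist y (x, u) < e" using z(2) by blast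
  qed
next
  fix x u
  assume xu: "(x, u) \<in> closure (Sigma UNIV H)"
  have "u \<in> closure (\<Union>z\<in>cball x d. H z)" if d: "0 < d" for d
    unfolding closure_approachable
  proof (intro allI impI)
    fix e :: real assume "0 < e"
    then obtain z v where z: "v \<in> H z" "dist (z, v) (x, u) < min d e"
      using xu d unfolding closure_approachable by (metis SigmaE min_less_iff_conj)
    have "dist z x < d" "dist v u < e"
      using z(2) dist_fst_le[of "(z, v)" "(x, u)"] dist_snd_le[of "(z, v)" "(x, u)"] by auto
    then show "\<exists>y\<in>\<Union>z\<in>cball x d. H z. dist y u < e"
      using z(1) by (intro bexI[of _ v] UN_I[of z]) (auto simp: dist_commute)
  qed
  then show "(x, u) \<in> Sigma UNIV (osc_hull H)" unfolding osc_hull_def by blast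
qed

text \<open>Applied with \<open>U\<close> as \<open>S\<close>, this keeps the regularized greedy
  controls admissible.\<close>

lemma osc_hull_subset:
  fixes H :: "'a::metric_space \<Rightarrow> 'b::metric_space set"
  assumes "closed (Sigma UNIV S)" "\<And>x. H x \<subseteq> S x"
  shows "osc_hull H x \<subseteq> S x"
proof -
  have "closure (Sigma UNIV H) \<subseteq> Sigma UNIV S"
    using assms by (intro closure_minimal) auto
  then show ?thesis unfolding Sigma_osc_hull[symmetric] by blast
qed

lemma locally_bounded_osc_hull:
  fixes H :: "'a::metric_space \<Rightarrow> 'b::metric_space set"
  assumes "locally_bounded H"
  shows "locally_bounded (osc_hull H)"
  unfolding locally_bounded_def
proof
  fix x
  obtain N where N: "open N" "x \<in> N" "bounded (\<Union>z\<in>N. H z)"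
    using assms unfolding locally_bounded_def by blast
  have "osc_hull H y \<subseteq> closure (\<Union>z\<in>N. H z)" if y: "y \<in> N" for y
  proof -
    obtain d where d: "0 < d" "cball y d \<subseteq> N"
      using N(1) y open_contains_cball by blast
    have "osc_hull H y \<subseteq> closure (\<Union>z\<in>cball y d. H z)"
      using d(1) unfolding osc_hull_def by blast
    also have "\<dots> \<subseteq> closure (\<Union>z\<in>N. H z)"
      using d(2) by (intro closure_mono) blast
    finally show ?thesis .
  qed
  then have "(\<Union>y\<in>N. osc_hull H y) \<subseteq> closure (\<Union>z\<in>N. H z)" by blast
  then show "\<exists>N. open N \<and> x \<in> N \<and> bounded (\<Union>z\<in>N. osc_hull H z)"
    using N by (meson bounded_closure bounded_subset)
qed

subsection \<open>Optimal feedback selections\<close>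

locale control_system =
  fixes f :: "'a::heine_borel \<Rightarrow> 'b::heine_borel \<Rightarrow> 'a" and l :: "'a \<Rightarrow> 'b \<Rightarrow> real"
  assumes f_cont: "continuous_on UNIV (\<lambda>(x, u). f x u)"
    and l_cont: "continuous_on UNIV (\<lambda>(x, u). l x u)"
    and l_nonneg: "\<And>x u. 0 \<le> l x u"
begin

text \<open>Moving the finite term \<open>l x u\<close> to the right exhibits the inequality as the
  preimage of the closed epigraph of \<open>V\<close> under a continuous map.\<close>

lemma closed_lookahead_sublevel:
  assumes "closed (Sigma UNIV S)" "lower_semicontinuous V"
  shows "closed {(x, u). u \<in> S x \<and> ereal (l x u) + V (f x u) \<le> ereal r}"
proof -
  have "continuous_on UNIV (\<lambda>p. ((\<lambda>(x, u). f x u) p, r - (\<lambda>(x, u). l x u) p))"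
    by (intro continuous_intros f_cont l_cont)
  then have "closed ((\<lambda>p. ((\<lambda>(x, u). f x u) p, r - (\<lambda>(x, u). l x u) p)) -` {(x, s::real). V x \<le> ereal s})"
    by (rule closed_vimage[OF lower_semicontinuous_imp_closed_epigraph[OF assms(2)]])
  moreover have "ereal (l x u) + V (f x u) \<le> ereal r \<longleftrightarrow> V (f x u) \<le> ereal (r - l x u)" for x u
    by (cases "V (f x u)") auto
  then have "{(x, u). u \<in> S x \<and> ereal (l x u) + V (f x u) \<le> ereal r}
    = Sigma UNIV S \<inter> ((\<lambda>p. ((\<lambda>(x, u). f x u) p, r - (\<lambda>(x, u). l x u) p)) -` {(x, s::real). V x \<le> ereal s})"
    by auto
  ultimately show ?thesis using assms(1) by (simp add: closed_Int)
qed

text \<open>Shifting the closed loop by one step turns a partial sum from the successor state, with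
  the first stage cost added, into a partial sum from \<open>x\<close>.\<close>

lemma stage_cost_plus_policy_cost_le:
  "ereal (l x (h x)) + policy_cost f l h (f x (h x)) \<le> policy_cost f l h x"
proof -
  let ?c = "\<lambda>x k. ereal (l (closed_loop f h x k) (h (closed_loop f h x k)))"
  have loop_Suc: "closed_loop f h x (Suc k) = closed_loop f h (f x (h x)) k" for k
    by (induction k) simp_all
  have "(\<Sum>k<N. ?c (f x (h x)) k) + ereal (l x (h x)) \<le> policy_cost f l h x" for N
  proof -
    have "(\<Sum>k<N. ?c (f x (h x)) k) + ereal (l x (h x)) = (\<Sum>k<Suc N. ?c x k)"
      unfolding sum.lessThan_Suc_shift loop_Suc by (simp add: add.commute)
    also have "\<dots> \<le> policy_cost f l h x"
      unfolding policy_cost_def by (rule suminf_upper) (simp add: l_nonneg)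
    finally show ?thesis .
  qed
  then have "policy_cost f l h (f x (h x)) + ereal (l x (h x)) \<le> policy_cost f l h x"
    unfolding policy_cost_def[of f l h "f x (h x)"]
    by (intro suminf_bound_add allI) (simp_all add: l_nonneg)
  then show ?thesis by (simp add: add.commute)
qed

lemma policy_cost_nonneg: "0 \<le> policy_cost f l h x"
  unfolding policy_cost_def by (intro suminf_0_le) (simp add: l_nonneg)

text \<open>Along the closed loop, the accumulated cost plus \<open>V\<close> at the current state
  never increases. Since \<open>V\<close> is nonnegative, dropping it bounds every partial sum by
  \<open>V x\<close>.\<close>

lemma policy_cost_le_supersolution:
  assumes V: "\<And>x. 0 \<le> V x" "\<And>x. ereal (l x (h x)) + V (f x (h x)) \<le> V x"
  shows "policy_cost f l h x \<le> V x"
  unfolding policy_cost_def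
proof (rule suminf_bound)
  let ?c = "closed_loop f h x"
  have "(\<Sum>k<N. ereal (l (?c k) (h (?c k)))) + V (?c N) \<le> V x" for N
  proof (induction N)
    case (Suc N)
    have "(\<Sum>k<Suc N. ereal (l (?c k) (h (?c k)))) + V (?c (Suc N))
      = (\<Sum>k<N. ereal (l (?c k) (h (?c k)))) + (ereal (l (?c N) (h (?c N))) + V (f (?c N) (h (?c N))))"
      by (simp add: add.assoc del: sum_ereal)
    also have "\<dots> \<le> (\<Sum>k<N. ereal (l (?c k) (h (?c k)))) + V (?c N)"
      by (intro add_left_mono V)
    finally show ?case using Suc by (rule order_trans)
  qed simp
  moreover have "(\<Sum>k<N. ereal (l (?c k) (h (?c k)))) \<le>
      (\<Sum>k<N. ereal (l (?c k) (h (?c k)))) + V (?c N)" for N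
    using add_left_mono[OF V(1)] by fastforce
  ultimately show "\<forall>N. (\<Sum>k<N. ereal (l (?c k) (h (?c k)))) \<le> V x"
    by (blast intro: order_trans)
qed (simp add: l_nonneg)

text \<open>
  The optimal feedback is found by value iteration from 0. Its limit is a supersolution because
  the sets of controls that are good enough for the n-th iterate are nested compact sets.
\<close>
lemma optimal_selection_exists:
  assumes ne: "\<And>x. S x \<noteq> {}" and cl: "closed (Sigma UNIV S)" and lb: "locally_bounded S"
  shows "\<exists>h. (\<forall>x. h x \<in> S x) \<and> lower_semicontinuous (policy_cost f l h)
    \<and> (\<forall>g. (\<forall>x. g x \<in> S x) \<longrightarrow> (\<forall>x. policy_cost f l h x \<le> policy_cost f l g x))"
proof -
  define T where "T V x = (INF u\<in>S x. ereal (l x u) + V (f x u))" for V :: "'a \<Rightarrow> ereal" and x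
  define v where "v n = (T ^^ n) (\<lambda>_. 0)" for n :: nat
  define C where "C V r = {(x, u). u \<in> S x \<and> ereal (l x u) + V (f x u) \<le> ereal r}" for V r
  have v_Suc: "v (Suc n) x = (INF u\<in>S x. ereal (l x u) + v n (f x u))" for n x
    by (simp add: v_def T_def)
  have v_nonneg: "0 \<le> v n x" for n x
  proof (induction n arbitrary: x)
    case (Suc n)
    show ?case unfolding v_Suc
      by (intro INF_greatest add_nonneg_nonneg Suc) (simp add: l_nonneg)
  qed (simp add: v_def)
  have C: "closed (C V r)" "C V r \<subseteq> Sigma UNIV S" if "lower_semicontinuous V" for V r
    using closed_lookahead_sublevel[OF cl that] by (auto simp: C_def)
  \<comment> \<open>Semicontinuity stays a premise here, because attainment at stage
    \<open>n\<close> is what proves semicontinuity at stage \<open>Suc n\<close>.\<close>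
  have v_min: "\<exists>u\<in>S x. v (Suc n) x = ereal (l x u) + v n (f x u)"
    if lsc: "lower_semicontinuous (v n)" for n x
  proof -
    have "\<exists>u\<in>S x. \<forall>w\<in>S x. ereal (l x u) + v n (f x u) \<le> ereal (l x w) + v n (f x w)"
    proof (rule attains_min_compact_sublevels)
      show "S x \<noteq> {}" by (rule ne)
      show "0 \<le> ereal (l x u) + v n (f x u)" for u
        by (intro add_nonneg_nonneg v_nonneg) (simp add: l_nonneg)
      show "compact {u \<in> S x. ereal (l x u) + v n (f x u) \<le> ereal r}" for r
        using compact_value_locally_bounded[OF C[OF lsc] lb, of x r]
        by (simp add: C_def vimage_def)
    qed
    then obtain u where "u \<in> S x" "\<forall>w\<in>S x. ereal (l x u) + v n (f x u) \<le> ereal (l x w) + v n (f x w)"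
      by blast
    then show ?thesis
      unfolding v_Suc by (intro bexI[of _ u] antisym INF_lower INF_greatest) auto
  qed
  have v_lsc: "lower_semicontinuous (v n)" for n
  proof (induction n)
    case 0
    then show ?case
      by (simp add: v_def lower_semicontinuous_def le_Liminf_iff)
  next
    case (Suc n)
    \<comment> \<open>Attainment makes the projection exact; an unattained infimum could equal
      \<open>r\<close> with no control reaching that level.\<close>
    have "{x. v (Suc n) x \<le> ereal r} = fst ` C (v n) r" for r
    proof (intro subset_antisym subsetI)
      fix x assume "x \<in> {x. v (Suc n) x \<le> ereal r}"
      then obtain u where "(x, u) \<in> C (v n) r"
        using v_min[OF Suc, of x] by (auto simp: C_def)
      then show "x \<in> fst ` C (v n) r" by force
    next
      fix x assume "x \<in> fst ` C (v n) r"
      then show "x \<in> {x. v (Suc n) x \<le> ereal r}"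
        unfolding v_Suc C_def by (auto intro: INF_lower2)
    qed
    then show ?case
      unfolding lower_semicontinuous_iff_closed_sublevel
      using closed_fst_image_locally_bounded[OF C[OF Suc] lb] by simp
  qed
  have "v n x \<le> v (Suc n) x" for n x
  proof (induction n arbitrary: x)
    case 0
    show ?case using v_nonneg[of "Suc 0"] by (simp add: v_def)
  next
    case (Suc n)
    show ?case
      unfolding v_Suc[of "Suc n" x] v_Suc[of n x]
      by (intro INF_mono) (blast intro: add_left_mono Suc)
  qed
  then have v_mono: "v n x \<le> v k x" if "n \<le> k" for n k x
    using that by (rule lift_Suc_mono_le[of "\<lambda>n. v n x"])
  define w where "w x = (SUP n. v n x)" for x
  have w_upper: "v n x \<le> w x" for n x
    unfolding w_def by (rule SUP_upper) simp
  then have w_nonneg: "0 \<le> w x" for x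
    using v_nonneg order_trans by blast
  have w_lsc: "lower_semicontinuous w"
    unfolding w_def by (intro lower_semicontinuous_SUP v_lsc)
  have "\<exists>u\<in>S x. ereal (l x u) + w (f x u) \<le> w x" for x
  proof (cases "w x = \<infinity>")
    case True
    then show ?thesis using ne[of x] by auto
  next
    case False
    then obtain r where r: "w x = ereal r"
      using w_nonneg[of x] by (cases "w x") auto
    \<comment> \<open>A minimizer for \<open>v (Suc n) x \<le> w x\<close> lies in the fibre with
      index \<open>n\<close>. A control common to all fibres serves every iterate, hence also their
      supremum \<open>w\<close>.\<close>
    have "\<Inter>(range (\<lambda>n. Pair x -` C (v n) r)) \<noteq> {}"
    proof (rule compact_nest)
      show "compact (Pair x -` C (v n) r)" for n
        by (rule compact_value_locally_bounded[OF C[OF v_lsc] lb])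
      show "Pair x -` C (v n) r \<noteq> {}" for n
        using v_min[OF v_lsc, of x n] w_upper[of "Suc n" x] by (auto simp: C_def r)
      show "Pair x -` C (v n) r \<subseteq> Pair x -` C (v k) r" if "k \<le> n" for k n
        using v_mono[OF that] by (auto simp: C_def intro: order_trans[OF add_left_mono])
    qed
    then obtain u where u: "\<And>n. u \<in> S x \<and> ereal (l x u) + v n (f x u) \<le> ereal r"
      by (auto simp: C_def)
    have "v n (f x u) \<le> ereal (r - l x u)" for n
      using u[of n] by (cases "v n (f x u)") auto
    then have "w (f x u) \<le> ereal (r - l x u)"
      unfolding w_def by (intro SUP_least)
    then have "ereal (l x u) + w (f x u) \<le> w x"
      unfolding r by (cases "w (f x u)") auto
    then show ?thesis using u by blast
  qed
  then obtain h where h: "\<And>x. h x \<in> S x" "\<And>x. ereal (l x (h x)) + w (f x (h x)) \<le> w x"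
    by metis
  \<comment> \<open>This bound shows that no feedback beats \<open>w\<close>; for \<open>h\<close>
    it also complements the supersolution bound, so that the cost of \<open>h\<close> is exactly
    \<open>w\<close>.\<close>
  have lower: "w x \<le> policy_cost f l g x" if g: "\<And>x. g x \<in> S x" for g x
    unfolding w_def
  proof (rule SUP_least)
    show "v n x \<le> policy_cost f l g x" for n
    proof (induction n arbitrary: x)
      case (Suc n)
      have "v (Suc n) x \<le> ereal (l x (g x)) + v n (f x (g x))"
        unfolding v_Suc by (intro INF_lower g)
      also have "\<dots> \<le> ereal (l x (g x)) + policy_cost f l g (f x (g x))"
        by (intro add_left_mono Suc)
      also have "\<dots> \<le> policy_cost f l g x"
        by (rule stage_cost_plus_policy_cost_le)
      finally show ?case .
    qed (simp add: v_def policy_cost_nonneg)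
  qed
  have "policy_cost f l h = w"
    using policy_cost_le_supersolution[OF w_nonneg h(2)] lower[OF h(1)]
    by (intro ext antisym) auto
  then show ?thesis using h(1) w_lsc lower by metis
qed

section \<open>One step of policy iteration\<close>

lemma minimum_eqI:
  assumes "a \<in> A" "\<And>b. b \<in> A \<Longrightarrow> a \<le> b"
  shows "minimum A = a"
  unfolding minimum_def using assms by (rule Least_equality)

text \<open>The continuous majorant \<open>b\<close> bounds the stage cost of greedy controls, so
  level-boundedness makes these controls locally bounded. The conclusions restore for
  \<open>W\<close> the hypotheses on \<open>V\<close>, with the same \<open>b\<close> because
  \<open>W x \<le> V x\<close>, so the step can be iterated.\<close>

lemma policy_iteration_step:
  fixes b :: "'a \<Rightarrow> real"
  assumes U: "closed (Sigma UNIV U)" and lev: "level_bounded_locally_uniform l"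
    and V: "lower_semicontinuous V" "V = policy_cost f l h" "\<And>x. h x \<in> U x"
    and b: "\<And>x. V x \<le> ereal (b x)" "continuous_on UNIV b"
    and H: "H = (\<lambda>x. argmin_set (\<lambda>u. ereal (l x u) + V (f x u)) (U x))"
    and W: "W = (\<lambda>x. minimum {policy_cost f l g x |g. selection (osc_hull H) g})"
  shows "lower_semicontinuous W" "\<exists>g. W = policy_cost f l g \<and> (\<forall>x. g x \<in> U x)"
    "\<And>x. W x \<le> V x" "\<And>x u. u \<in> U x \<Longrightarrow> W x \<le> ereal (l x u) + V (f x u)"
proof -
  have V_nonneg: "0 \<le> V x" for x
    unfolding V(2) by (rule policy_cost_nonneg)
  have H_iff: "u \<in> H x \<longleftrightarrow> u \<in> U x \<and>
      (\<forall>v\<in>U x. ereal (l x u) + V (f x u) \<le> ereal (l x v) + V (f x v))" for x u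
    unfolding H argmin_set_def by (auto simp: is_arg_min_linorder)
  have H_sub: "H x \<subseteq> U x" for x by (auto simp: H_iff)
  \<comment> \<open>The control \<open>h x\<close> competes in the minimization, and
    \<open>V\<close> is the cost of \<open>h\<close>.\<close>
  have H_V: "ereal (l x u) + V (f x u) \<le> V x" if "u \<in> H x" for x u
    using that V(3)[of x] stage_cost_plus_policy_cost_le[of x h]
    unfolding H_iff V(2) by (blast intro: order_trans)
  have H_b: "l x u \<le> b x" if "u \<in> H x" for x u
  proof -
    have "ereal (l x u) \<le> ereal (l x u) + V (f x u)"
      using add_left_mono[OF V_nonneg] by fastforce
    also have "\<dots> \<le> ereal (b x)" using H_V[OF that] b(1) by (rule order_trans)
    finally show ?thesis by simp
  qed
  have H_ne: "H x \<noteq> {}" for x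
  proof -
    have "\<exists>u\<in>U x. \<forall>v\<in>U x. ereal (l x u) + V (f x u) \<le> ereal (l x v) + V (f x v)"
    proof (rule attains_min_compact_sublevels)
      show "U x \<noteq> {}" using V(3) by blast
      show "0 \<le> ereal (l x u) + V (f x u)" for u
        by (intro add_nonneg_nonneg V_nonneg) (simp add: l_nonneg)
      fix r :: real
      have "closed (Pair x -` {(x, u). u \<in> U x \<and> ereal (l x u) + V (f x u) \<le> ereal r})"
        using closed_lookahead_sublevel[OF U V(1)]
        by (intro continuous_closed_vimage) (auto intro!: continuous_intros)
      moreover have "bounded {u. l x u \<le> r}"
        using lev unfolding level_bounded_locally_uniform_def by (meson bounded_subset)
      moreover have "{u \<in> U x. ereal (l x u) + V (f x u) \<le> ereal r} \<subseteq> {u. l x u \<le> r}"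
      proof clarify
        fix u assume "ereal (l x u) + V (f x u) \<le> ereal r"
        then show "l x u \<le> r" using V_nonneg[of "f x u"] by (cases "V (f x u)") auto
      qed
      ultimately show "compact {u \<in> U x. ereal (l x u) + V (f x u) \<le> ereal r}"
        by (simp add: compact_eq_bounded_closed bounded_subset vimage_def)
    qed
    then show ?thesis using H_iff by blast
  qed
  have H_lb: "locally_bounded H"
    unfolding locally_bounded_def
  proof
    fix x
    obtain S B where S: "open S" "x \<in> S" "bounded B" "\<And>z. z \<in> S \<Longrightarrow> {u. l z u \<le> b x + 1} \<subseteq> B"
      using lev unfolding level_bounded_locally_uniform_def by meson
    \<comment> \<open>The slack 1 absorbs the variation of \<open>b\<close> near \<open>x\<close>,
      so a single level of \<open>l\<close> captures all greedy controls over
      \<open>?N\<close>.\<close>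
    let ?N = "S \<inter> b -` {..<b x + 1}"
    have "open ?N"
      using S(1) b(2) by (intro open_Int open_vimage open_lessThan)
    moreover have "(\<Union>z\<in>?N. H z) \<subseteq> B"
    proof clarify
      fix z u assume z: "z \<in> S" "b z < b x + 1" "u \<in> H z"
      then have "l z u \<le> b x + 1" using H_b[of u z] by simp
      then show "u \<in> B" using S(4) z(1) by blast
    qed
    ultimately show "\<exists>N. open N \<and> x \<in> N \<and> bounded (\<Union>z\<in>N. H z)"
      using S(2,3) by (intro exI[of _ ?N]) (auto intro: bounded_subset)
  qed
  \<comment> \<open>A selection is constrained only where the value is nonempty; existence of greedy
    controls makes that every state.\<close>
  have sel: "selection (osc_hull H) g \<longleftrightarrow> (\<forall>x. g x \<in> osc_hull H x)" for g
    unfolding selection_def using H_ne subset_osc_hull[of H] by blast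
  have "\<exists>g. (\<forall>x. g x \<in> osc_hull H x) \<and> lower_semicontinuous (policy_cost f l g)
    \<and> (\<forall>g'. (\<forall>x. g' x \<in> osc_hull H x) \<longrightarrow> (\<forall>x. policy_cost f l g x \<le> policy_cost f l g' x))"
  proof (rule optimal_selection_exists)
    show "osc_hull H x \<noteq> {}" for x using H_ne subset_osc_hull[of H] by blast
    show "closed (Sigma UNIV (osc_hull H))" by (simp add: Sigma_osc_hull)
    show "locally_bounded (osc_hull H)" using H_lb by (rule locally_bounded_osc_hull)
  qed
  then obtain g where g: "\<And>x. g x \<in> osc_hull H x" "lower_semicontinuous (policy_cost f l g)"
    "\<And>g' x. (\<And>y. g' y \<in> osc_hull H y) \<Longrightarrow> policy_cost f l g x \<le> policy_cost f l g' x"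
    by blast
  have W_eq: "W = policy_cost f l g"
    unfolding W by (intro ext minimum_eqI) (use g in \<open>auto simp: sel\<close>)
  show "lower_semicontinuous W" unfolding W_eq by (rule g(2))
  show "\<exists>g. W = policy_cost f l g \<and> (\<forall>x. g x \<in> U x)"
    using W_eq g(1) osc_hull_subset[OF U H_sub] by blast
  have "\<forall>x. \<exists>u. u \<in> H x" using H_ne by blast
  then obtain k where k: "\<And>x. k x \<in> H x" by metis
  \<comment> \<open>The minimal lookahead value is a supersolution for \<open>k\<close>, since it
    lies below \<open>V\<close> at the successor state. Bounding \<open>W\<close> by it gives both
    remaining conclusions at once.\<close>
  let ?T = "\<lambda>x. ereal (l x (k x)) + V (f x (k x))"
  have "policy_cost f l k x \<le> ?T x" for x
  proof (rule policy_cost_le_supersolution)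
    show "0 \<le> ?T x" for x
      by (intro add_nonneg_nonneg V_nonneg) (simp add: l_nonneg)
    show "ereal (l x (k x)) + ?T (f x (k x)) \<le> ?T x" for x
      by (intro add_left_mono H_V k)
  qed
  then have W_T: "W x \<le> ?T x" for x
    unfolding W_eq using g(3)[of k x] k subset_osc_hull[of H] by (meson order_trans subsetD)
  show "W x \<le> V x" for x
    using W_T H_V[OF k] by (rule order_trans)
  show "W x \<le> ereal (l x u) + V (f x u)" if "u \<in> U x" for x u
    using W_T k[of x] that H_iff by (meson order_trans)
qed

end

subsection \<open>Detectability and convergence\<close>

lemma class_K_inf_mono:
  assumes "class_K_inf \<alpha>" "0 \<le> r" "r \<le> t"
  shows "\<alpha> r \<le> \<alpha> t"
  using assms strict_mono_on_leD[of "{0..}" \<alpha> r t] by (simp add: class_K_inf_def)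

lemma class_K_inf_small:
  assumes \<alpha>: "class_K_inf \<alpha>" and "0 < e"
  shows "\<exists>d>0. \<forall>t. 0 \<le> t \<longrightarrow> t \<le> d \<longrightarrow> \<alpha> t \<le> e"
proof -
  have "continuous (at 0 within {0..}) \<alpha>" "\<alpha> 0 = 0"
    using \<alpha> by (auto simp: class_K_inf_def continuous_on_eq_continuous_within)
  then obtain d where d: "0 < d" "\<And>t. 0 \<le> t \<Longrightarrow> t < d \<Longrightarrow> \<bar>\<alpha> t\<bar> < e"
    using \<open>0 < e\<close> unfolding continuous_within_eps_delta
    by (auto simp: dist_real_def dest!: spec[of _ e])
  have "\<alpha> t \<le> e" if "0 \<le> t" "t \<le> d / 2" for t
    using d(2)[of t] that d(1) by simp
  then show ?thesis using d(1) half_gt_zero by blast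
qed

text \<open>
  Counting argument: as long as the state stays away from the set where \<open>\<sigma>\<close> vanishes, cheap
  stages decrease \<open>W\<close> by a fixed amount, and a bounded total cost leaves room for only boundedly
  many expensive stages.
\<close>
lemma detectable_visits_small:
  assumes aW: "class_K_inf \<alpha>W" and cW: "class_K_inf \<chi>W"
    and \<epsilon>: "0 < \<epsilon>"
  shows "\<exists>N::nat. \<forall>w s c. (\<forall>k. 0 \<le> w k) \<and> (\<forall>k. 0 \<le> c k) \<and> w 0 \<le> B \<and> (\<forall>n. (\<Sum>k<n. c k) \<le> M)
      \<and> (\<forall>k. w (Suc k) - w k \<le> - \<alpha>W (s k) + \<chi>W (c k)) \<longrightarrow> (\<exists>k\<le>N. s k \<le> \<epsilon>)"
proof -
  have c_nonneg: "0 \<le> \<chi>W t" if "0 \<le> t" for t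
    using class_K_inf_mono[OF cW, of 0 t] that cW by (simp add: class_K_inf_def)
  define a where "a = \<alpha>W \<epsilon>"
  have a: "0 < a"
    using aW \<epsilon> strict_mono_onD[of "{0..}" \<alpha>W 0 \<epsilon>] by (simp add: class_K_inf_def a_def)
  obtain d where d: "0 < d" "\<And>t. 0 \<le> t \<Longrightarrow> t \<le> d \<Longrightarrow> \<chi>W t \<le> a / 2"
    using class_K_inf_small[OF cW half_gt_zero[OF a]] by blast
  \<comment> \<open>A slope with \<open>\<chi>W t \<le> q * t\<close> for costs \<open>t\<close>
    between \<open>d\<close> and \<open>M\<close>; \<open>max M 0\<close> keeps the argument of
    \<open>\<chi>W\<close> nonnegative.\<close>
  define q where "q = (\<chi>W (max M 0) + a / 2) / d"
  have q: "0 \<le> q" unfolding q_def using a d c_nonneg[of "max M 0"] by simp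
  \<comment> \<open>Losing \<open>a / 2\<close> in each of \<open>N\<close> stages then exceeds the
    initial \<open>B\<close> plus the total gain \<open>q * M\<close>, which would make
    \<open>w N\<close> negative.\<close>
  obtain N :: nat where N: "(B + q * M) / (a / 2) < N" using reals_Archimedean2 by blast
  show ?thesis
  proof (rule exI[of _ N], intro allI impI, elim conjE)
    fix w s c :: "nat \<Rightarrow> real"
    assume w: "\<forall>k. 0 \<le> w k" "w 0 \<le> B" "\<forall>k. w (Suc k) - w k \<le> - \<alpha>W (s k) + \<chi>W (c k)"
      and c: "\<forall>k. 0 \<le> c k" "\<forall>n. (\<Sum>k<n. c k) \<le> M"
    show "\<exists>k\<le>N. s k \<le> \<epsilon>"
    proof (rule ccontr)
      assume "\<not> (\<exists>k\<le>N. s k \<le> \<epsilon>)"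
      then have s: "\<epsilon> \<le> s k" if "k \<le> N" for k using that by force
      have cM: "c k \<le> M" for k
        using c(2)[rule_format, of "Suc k"] sum_nonneg[of "{..<k}" c] c(1) by simp
      \<comment> \<open>One estimate covers both kinds of stage: a cheap one spends at most half of
        the decrease \<open>a\<close>, an expensive one is charged to
        \<open>q * c k\<close>.\<close>
      have step: "w (Suc k) - w k \<le> - (a / 2) + q * c k" if "k \<le> N" for k
      proof -
        have "w (Suc k) - w k \<le> - a + \<chi>W (c k)"
          using w(3)[rule_format, of k] class_K_inf_mono[OF aW _ s[OF that]] \<epsilon> unfolding a_def by simp
        also have "\<chi>W (c k) \<le> a / 2 + q * c k"
        proof (cases "c k \<le> d")
          case True
          then show ?thesis using d(2)[of "c k"] c(1) q by (simp add: add_increasing2)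
        next
          case False
          have "\<chi>W (c k) \<le> \<chi>W (max M 0)" using cM[of k] c(1) by (intro class_K_inf_mono[OF cW]) auto
          also have "\<dots> \<le> q * d" unfolding q_def using d a by simp
          also have "\<dots> \<le> q * c k" using False q by (intro mult_left_mono) auto
          finally show ?thesis using a by simp
        qed
        finally show ?thesis by simp
      qed
      have "w n \<le> w 0 - n * (a / 2) + q * (\<Sum>k<n. c k)" if "n \<le> N" for n
        using that
      proof (induction n)
        case (Suc n)
        then show ?case using step[of n] by (simp add: algebra_simps add_divide_distrib)
      qed simp
      then have "w N \<le> w 0 - N * (a / 2) + q * (\<Sum>k<N. c k)" by simp
      also have "\<dots> \<le> B - N * (a / 2) + q * M"
        using w(2) c(2) q by (intro add_mono diff_mono mult_left_mono) auto
      also have "\<dots> < 0" using N a by (simp add: field_simps)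
      finally show False using w(1) by (simp add: leD)
    qed
  qed
qed

section \<open>Monotone and compact convergence of the iteration\<close>

theorem proposition2:
  fixes f :: "real ^ 'nx \<Rightarrow> real ^ 'nu \<Rightarrow> real ^ 'nx"
    and l :: "real ^ 'nx \<Rightarrow> real ^ 'nu \<Rightarrow> real"
    and U :: "real ^ 'nx \<Rightarrow> (real ^ 'nu) set"
    and h0 :: "real ^ 'nx \<Rightarrow> real ^ 'nu"
    and \<sigma> :: "real ^ 'nx \<Rightarrow> real"
  assumes U_nonempty: "\<And>x. U x \<noteq> {}"
    and l_nonneg: "\<And>x u. l x u \<ge> 0"
    and sigma_cont: "continuous_on UNIV \<sigma>"
    and sigma_nonneg: "\<And>x. \<sigma> x \<ge> 0"
    and h0_policy: "selection U h0"
    and SA1: "\<And>x. \<exists>u. is_arg_min (seq_cost f l x) (admissible f U x) u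
                    \<and> optimal_value f l U x = seq_cost f l x u \<and> seq_cost f l x u < \<infinity>"
    and SA2: "\<exists>W \<alpha>W \<chi>W \<alpha>W'.
        continuous_on UNIV W \<and> (\<forall>x. W x \<ge> 0) \<and> class_K_inf \<alpha>W \<and> class_K_inf \<chi>W
        \<and> continuous_on {0..} \<alpha>W' \<and> mono_on {0..} \<alpha>W' \<and> \<alpha>W' 0 = 0
        \<and> (\<forall>x. \<forall>u \<in> U x. W x \<le> \<alpha>W' (\<sigma> x)
              \<and> W (f x u) - W x \<le> - \<alpha>W (\<sigma> x) + \<chi>W (l x u))"
    and SA3: "\<exists>\<alpha>V. class_K_inf \<alpha>V \<and> (\<forall>x. policy_cost f l h0 x \<le> ereal (\<alpha>V (\<sigma> x)))"
    and f_cont: "continuous_on UNIV (\<lambda>(x, u). f x u)"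
    and l_cont: "continuous_on UNIV (\<lambda>(x, u). l x u)"
    and l_level_bounded: "level_bounded_locally_uniform l"
    and U_osc: "outer_semicontinuous U"
    and Vr0_lsc: "lower_semicontinuous (PI_Vr f l U h0 0)"
    and sigma_compact: "\<And>\<Delta>. \<Delta> > 0 \<Longrightarrow> compact {x. \<sigma> x \<le> \<Delta>}"
  shows "(\<forall>i x. PI_Vr f l U h0 (Suc i) x \<le> PI_Vr f l U h0 i x)
       \<and> (\<forall>K \<delta>. compact K \<and> \<delta> > 0 \<longrightarrow>
            (\<exists>i0>0. \<forall>x\<in>K. \<forall>i\<ge>i0.
               PI_Vr f l U h0 i x - optimal_value f l U x \<le> ereal \<delta>))"
proof -
  obtain W \<alpha>W \<chi>W where W: "continuous_on UNIV W" "\<And>x. 0 \<le> W x" "class_K_inf \<alpha>W" "class_K_inf \<chi>W"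
    and W_step: "\<And>x u. u \<in> U x \<Longrightarrow> W (f x u) - W x \<le> - \<alpha>W (\<sigma> x) + \<chi>W (l x u)"
    using SA2 by blast
  obtain \<alpha>V where \<alpha>V: "class_K_inf \<alpha>V" and h0_cost: "\<And>x. policy_cost f l h0 x \<le> ereal (\<alpha>V (\<sigma> x))"
    using SA3 by blast
  interpret control_system f l
    by unfold_locales (use f_cont l_cont l_nonneg in auto)
  have h0: "h0 x \<in> U x" for x
    using h0_policy U_nonempty[of x] unfolding selection_def by blast
  have U_closed: "closed (Sigma UNIV U)"
    using U_osc by (rule outer_semicontinuous_imp_closed_graph)
  define b where "b x = \<alpha>V (\<sigma> x)" for x
  have b_cont: "continuous_on UNIV b"
    unfolding b_def using \<alpha>V sigma_cont sigma_nonneg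
    by (intro continuous_on_compose2[of "{0..}" \<alpha>V UNIV \<sigma>]) (auto simp: class_K_inf_def)
  define V where "V = PI_Vr f l U h0"
  have V_0: "V 0 = policy_cost f l h0" by (simp add: V_def)
  have V_Suc: "V (Suc i) = (\<lambda>x. minimum {policy_cost f l g x |g. selection (osc_hull (PI_H f l U h0 (Suc i))) g})"
    for i by (simp add: V_def osc_hull_def[abs_def])
  have H_Suc: "PI_H f l U h0 (Suc i) = (\<lambda>x. argmin_set (\<lambda>u. ereal (l x u) + V i (f x u)) (U x))" for i
    by (simp add: V_def)
  \<comment> \<open>The bound by \<open>V 0\<close> is carried along so that the single function
    \<open>b\<close> dominates every iterate.\<close>
  have inv: "lower_semicontinuous (V i) \<and> (\<exists>g. V i = policy_cost f l g \<and> (\<forall>x. g x \<in> U x)) \<and> (\<forall>x. V i x \<le> V 0 x)"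
    and step: "V (Suc i) x \<le> V i x" "u \<in> U x \<Longrightarrow> V (Suc i) x \<le> ereal (l x u) + V i (f x u)" for i x u
  proof -
    have one_step: "lower_semicontinuous (V (Suc i))" "\<exists>g. V (Suc i) = policy_cost f l g \<and> (\<forall>x. g x \<in> U x)"
      "\<And>x. V (Suc i) x \<le> V i x" "\<And>x u. u \<in> U x \<Longrightarrow> V (Suc i) x \<le> ereal (l x u) + V i (f x u)"
      if i: "lower_semicontinuous (V i) \<and> (\<exists>g. V i = policy_cost f l g \<and> (\<forall>x. g x \<in> U x)) \<and> (\<forall>x. V i x \<le> V 0 x)"
      for i
    proof -
      obtain g where g: "V i = policy_cost f l g" "\<And>x. g x \<in> U x" using i by blast
      have "V i x \<le> ereal (b x)" for x
        using i h0_cost[of x] unfolding V_0 b_def by (blast intro: order_trans)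
      note policy_iteration_step[OF U_closed l_level_bounded _ g this b_cont H_Suc V_Suc]
      with i show "lower_semicontinuous (V (Suc i))" "\<exists>g. V (Suc i) = policy_cost f l g \<and> (\<forall>x. g x \<in> U x)"
        "\<And>x. V (Suc i) x \<le> V i x" "\<And>x u. u \<in> U x \<Longrightarrow> V (Suc i) x \<le> ereal (l x u) + V i (f x u)"
        by blast+
    qed
    show inv: "lower_semicontinuous (V i) \<and> (\<exists>g. V i = policy_cost f l g \<and> (\<forall>x. g x \<in> U x)) \<and> (\<forall>x. V i x \<le> V 0 x)" for i
    proof (induction i)
      case 0
      show ?case using Vr0_lsc h0 V_0 by (auto simp: V_def)
    next
      case (Suc i)
      then show ?case using one_step[OF Suc] by (meson order_trans)
    qed
    show "V (Suc i) x \<le> V i x" "u \<in> U x \<Longrightarrow> V (Suc i) x \<le> ereal (l x u) + V i (f x u)"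
      using one_step[OF inv] by auto
  qed
  \<comment> \<open>Each time step along the trajectory lowers the iteration index by one, so
    \<open>m\<close> is generalized and the induction hypothesis is used at
    \<open>Suc m\<close>.\<close>
  have rollout: "V (m + k) x \<le> ereal (\<Sum>j<k. l (traj f x u j) (u j)) + V m (traj f x u k)"
    if u: "admissible f U x u" for m k x u
  proof (induction k arbitrary: m)
    case 0
    show ?case by (simp flip: zero_ereal_def)
  next
    case (Suc k)
    let ?c = "\<lambda>j. l (traj f x u j) (u j)"
    have "V (m + Suc k) x \<le> ereal (\<Sum>j<k. ?c j) + V (Suc m) (traj f x u k)"
      using Suc[of "Suc m"] by simp
    also have "\<dots> \<le> ereal (\<Sum>j<k. ?c j) + (ereal (?c k) + V m (traj f x u (Suc k)))"
      using u by (intro add_left_mono) (simp add: step(2) admissible_def)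
    also have "\<dots> = ereal (\<Sum>j<Suc k. ?c j) + V m (traj f x u (Suc k))"
      by (simp flip: plus_ereal.simps(1) add: add.assoc del: traj.simps)
    finally show ?case .
  qed
  have V_star: "\<exists>u. admissible f U x u \<and> optimal_value f l U x = seq_cost f l x u
      \<and> seq_cost f l x u \<le> ereal (b x)" for x
  proof -
    obtain u where u: "is_arg_min (seq_cost f l x) (admissible f U x) u"
      "optimal_value f l U x = seq_cost f l x u"
      using SA1 by blast
    \<comment> \<open>Replaying the closed loop of \<open>h0\<close> as an open-loop sequence gives
      the optimal cost the majorant \<open>b\<close>.\<close>
    define v where "v k = h0 (closed_loop f h0 x k)" for k
    have traj_v: "traj f x v k = closed_loop f h0 x k" for k
      by (induction k) (simp_all add: v_def)
    have "admissible f U x v"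
      using h0 by (simp add: admissible_def traj_v v_def)
    then have "seq_cost f l x u \<le> seq_cost f l x v"
      using u(1) by (simp add: is_arg_min_linorder)
    also have "\<dots> = policy_cost f l h0 x"
      by (simp add: seq_cost_def policy_cost_def traj_v v_def)
    also have "\<dots> \<le> ereal (b x)" unfolding b_def by (rule h0_cost)
    finally show ?thesis using u by (auto simp: is_arg_min_linorder)
  qed
  have "\<exists>i0>0. \<forall>x\<in>K. \<forall>i\<ge>i0. V i x - optimal_value f l U x \<le> ereal \<delta>"
    if K: "compact K" and \<delta>: "0 < \<delta>" for K \<delta>
  proof -
    have bdd: "\<exists>B. \<forall>x\<in>K. g x \<le> B" if "continuous_on UNIV g" for g :: "real ^ 'nx \<Rightarrow> real"
    proof -
      have "compact (g ` K)"
        using K continuous_on_subset[OF that] by (intro compact_continuous_image) auto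
      then have "bdd_above (g ` K)" by (intro bounded_imp_bdd_above compact_imp_bounded)
      then show ?thesis by (auto simp: bdd_above_def)
    qed
    obtain B where B: "\<And>x. x \<in> K \<Longrightarrow> W x \<le> B" using bdd[OF W(1)] by blast
    obtain M where M: "\<And>x. x \<in> K \<Longrightarrow> b x \<le> M" using bdd[OF b_cont] by blast
    \<comment> \<open>Once \<open>\<sigma>\<close> is at most \<open>\<epsilon>\<close>, the cost of
      \<open>h0\<close>, and with it every iterate, is at most \<open>\<delta>\<close>.\<close>
    obtain \<epsilon> where \<epsilon>: "0 < \<epsilon>" "\<And>t. 0 \<le> t \<Longrightarrow> t \<le> \<epsilon> \<Longrightarrow> \<alpha>V t \<le> \<delta>"
      using class_K_inf_small[OF \<alpha>V \<delta>] by blast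
    \<comment> \<open>The initial state enters only through \<open>B\<close> and \<open>M\<close>,
      which hold on all of \<open>K\<close>; this is the source of uniformity.\<close>
    obtain N :: nat where N: "\<And>w s c. \<lbrakk>\<And>k. 0 \<le> w k; \<And>k. 0 \<le> c k; w 0 \<le> B; \<And>n. (\<Sum>k<n. c k) \<le> M;
        \<And>k. w (Suc k) - w k \<le> - \<alpha>W (s k) + \<chi>W (c k)\<rbrakk> \<Longrightarrow> \<exists>k\<le>N. s k \<le> \<epsilon>"
      using detectable_visits_small[OF W(3,4) \<epsilon>(1), of B M] by blast
    \<comment> \<open>The threshold \<open>Suc N\<close> is positive, and any visit time
      \<open>k \<le> N\<close> makes \<open>i - k\<close> a genuine difference of naturals.\<close>
    have "V i x - optimal_value f l U x \<le> ereal \<delta>" if x: "x \<in> K" and i: "Suc N \<le> i" for x i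
    proof -
      obtain u where u: "admissible f U x u" "optimal_value f l U x = seq_cost f l x u"
        "seq_cost f l x u \<le> ereal (b x)"
        using V_star by blast
      define c where "c k = l (traj f x u k) (u k)" for k
      have sum_c: "ereal (\<Sum>k<n. c k) \<le> seq_cost f l x u" for n
        unfolding seq_cost_def c_def sum_ereal[symmetric]
        by (rule suminf_upper) (simp add: l_nonneg)
      have "\<exists>k\<le>N. \<sigma> (traj f x u k) \<le> \<epsilon>"
      proof (rule N[of "\<lambda>k. W (traj f x u k)" c])
        show "W (traj f x u 0) \<le> B" using B[OF x] by simp
        show "(\<Sum>k<n. c k) \<le> M" for n
        proof -
          have "ereal (\<Sum>k<n. c k) \<le> ereal (b x)"
            using sum_c u(3) by (rule order_trans)
          then show ?thesis using M[OF x] by simp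
        qed
        show "W (traj f x u (Suc k)) - W (traj f x u k) \<le> - \<alpha>W (\<sigma> (traj f x u k)) + \<chi>W (c k)" for k
          using u(1) W_step by (simp add: admissible_def c_def)
      qed (simp_all add: W(2) c_def l_nonneg)
      then obtain k where k: "k \<le> N" "\<sigma> (traj f x u k) \<le> \<epsilon>" by blast
      have "V i x \<le> ereal (\<Sum>j<k. c j) + V (i - k) (traj f x u k)"
        using rollout[OF u(1), of "i - k" k] k(1) i by (simp add: c_def)
      also have "\<dots> \<le> seq_cost f l x u + ereal \<delta>"
      proof (rule add_mono[OF sum_c])
        have "V (i - k) (traj f x u k) \<le> ereal (\<alpha>V (\<sigma> (traj f x u k)))"
          using inv[of "i - k"] h0_cost[of "traj f x u k"] unfolding V_0 by (blast intro: order_trans)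
        also have "\<dots> \<le> ereal \<delta>" using \<epsilon>(2)[OF sigma_nonneg k(2)] by simp
        finally show "V (i - k) (traj f x u k) \<le> ereal \<delta>" .
      qed
      finally have "V i x \<le> seq_cost f l x u + ereal \<delta>" .
      \<comment> \<open>With the upper bound \<open>b x\<close> this makes the optimal cost a real
        number, so it may be subtracted in \<open>ereal\<close>.\<close>
      moreover have "0 \<le> seq_cost f l x u" using sum_c[of 0] by (simp flip: zero_ereal_def)
      ultimately show ?thesis
        using u(2,3) by (cases "V i x"; cases "seq_cost f l x u") auto
    qed
    then show ?thesis by (intro exI[of _ "Suc N"]) blast
  qed
  then show ?thesis using step(1) unfolding V_def by blast
qed

end
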